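(* Let $\mu$ be a Borel probability measure on $\mathbb{C}$ with compact support $S$ such that for every compact $K\subset\mathbb{C}$, $$\sup_{z\in K}\int_S (\log|z-w|)^2\,d\mu(w)<\infty .$$ Let $U_\mu(z)=\int_S\log|z-w|\,d\mu(w)$, $\Omega^-=\{z\in\mathbb{C}:U_\mu(z)<0\}$ and $\Omega^+=\{z\in\mathbb{C}:U_\mu(z)>0\}$. Suppose $\Omega^-\neq\emptyset$ and let $\rho=\rho(\Omega^-)$ be its inradius. Let $X_1,X_2,\dots$ be i.i.d. random variables with distribution $\mu$, let $p_n(z)=\prod_{k=1}^n(z-X_k)$, $\Lambda_n=\{z\in\mathbb{C}:|p_n(z)|<1\}$, and let $\rho_n=\rho(\Lambda_n)$. Fix compact sets $K\subset\Omega^-$ and $L\subset\Omega^+\setminus S$. Then for all large $n$, $$K\subset\Lambda_n \ \text{ with overwhelming probability, and}\quad L\subset\Lambda_n^c\ \text{ with overwhelming probability.}$$ In particular, for every $a\in(0,\rho)$, $\rho_n\ge a$ with overwhelming probability.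
   Context: The inradius $\rho(U)$ of a set $U\subset\mathbb{C}$ is the supremum of the radii of open disks contained in $U$. $\Lambda_n^c$ is the complement $\mathbb{C}\setminus\Lambda_n$. A sequence of events $E_n$ holds with overwhelming probability if there is a constant $c>0$ (independent of $n$) such that $\mathbb{P}(E_n)\ge 1-e^{-cn}$ for all sufficiently large $n$; here $c$ may depend on $\mu$ and on the fixed data $K$, $L$, $a$. *)

theory Defs
  imports "HOL-Probability.Probability"
begin

definition measure_support :: "'a::topological_space measure \<Rightarrow> 'a set" where
  "measure_support \<mu> = {x. \<forall>U. open U \<longrightarrow> x \<in> U \<longrightarrow> emeasure \<mu> U > 0}"

(* (log |z - w|)^2 in [0, \<infinity>].  The value at w = z is \<infinity>, since log 0 = -\<infinity>; the library
   convention ln 0 = 0 would let measures with atoms satisfy the integrability hypothesis. *)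
definition log_dist_sq :: "complex \<Rightarrow> complex \<Rightarrow> ennreal" where
  "log_dist_sq z w = (if w = z then \<infinity> else ennreal ((ln (cmod (z - w)))\<^sup>2))"

definition log_sq_bounded :: "complex measure \<Rightarrow> bool" where
  "log_sq_bounded \<mu> \<longleftrightarrow>
     (\<forall>K. compact K \<longrightarrow>
        (SUP z\<in>K. \<integral>\<^sup>+w\<in>measure_support \<mu>. log_dist_sq z w \<partial>\<mu>) < \<infinity>)"

(* A real Bochner integral.  It is the usual logarithmic potential whenever log_sq_bounded \<mu>
   holds for a probability measure \<mu>: then the integrand is integrable for every z, and \<mu> has
   no atoms, so the value ln 0 = 0 at w = z does not matter. *)
definition log_potential :: "complex measure \<Rightarrow> complex \<Rightarrow> real" where
  "log_potential \<mu> z = (LINT w:measure_support \<mu>|\<mu>. ln (cmod (z - w)))"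

definition Omega_minus :: "complex measure \<Rightarrow> complex set" where
  "Omega_minus \<mu> = {z. log_potential \<mu> z < 0}"

definition Omega_plus :: "complex measure \<Rightarrow> complex set" where
  "Omega_plus \<mu> = {z. log_potential \<mu> z > 0}"

(* In [0, \<infinity>], so that sets with empty interior have inradius 0. *)
definition inradius :: "complex set \<Rightarrow> ennreal" where
  "inradius U = (SUP r\<in>{r. r > 0 \<and> (\<exists>c. ball c r \<subseteq> U)}. ennreal r)"

definition random_poly :: "(nat \<Rightarrow> 'a \<Rightarrow> complex) \<Rightarrow> nat \<Rightarrow> 'a \<Rightarrow> complex \<Rightarrow> complex" where
  "random_poly X n \<omega> z = (\<Prod>k=1..n. z - X k \<omega>)"

definition lemniscate :: "(nat \<Rightarrow> 'a \<Rightarrow> complex) \<Rightarrow> nat \<Rightarrow> 'a \<Rightarrow> complex set" where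
  "lemniscate X n \<omega> = {z. cmod (random_poly X n \<omega> z) < 1}"

(* Eventual measurability of E n is implied, because measure M A = 0 for non-measurable A. *)
definition overwhelming_probability :: "'a measure \<Rightarrow> (nat \<Rightarrow> 'a set) \<Rightarrow> bool" where
  "overwhelming_probability M E \<longleftrightarrow>
     (\<exists>c>0. \<forall>\<^sub>F n in sequentially. measure M (E n) \<ge> 1 - exp (- c * real n))"

end

theory Submission
  imports Defs "HOL-Real_Asymp.Real_Asymp"
begin

text \<open>
  Near a fixed point \<open>z\<close>, the number \<open>log |p\<^sub>n y|\<close> is bounded above by the sum of the i.i.d. variables
  \<open>log (|z - X\<^sub>k| + r)\<close> for all \<open>y\<close> in the disk of radius \<open>r\<close> around \<open>z\<close>, and, if \<open>z\<close> lies off the support,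
  below by the sum of \<open>log (|z - X\<^sub>k| - r)\<close>. These variables are bounded, and by dominated convergence
  their means tend to the potential at \<open>z\<close> as \<open>r\<close> tends to 0. So for small \<open>r\<close> the mean has the sign
  of the potential, and Hoeffding's inequality controls a whole disk with exponentially small failure
  probability; finitely many disks cover a compact set.
\<close>

section \<open>Exponential decay for sums of bounded i.i.d. variables with negative mean\<close>

lemma (in prob_space) overwhelming_probability_iid_sum_neg:
  fixes X :: "nat \<Rightarrow> 'a \<Rightarrow> 'b::topological_space" and g :: "'b \<Rightarrow> real"
  assumes indep: "indep_vars (\<lambda>_. borel) X {1..}"
    and distr: "\<And>k. k \<ge> 1 \<Longrightarrow> distr M borel (X k) = \<mu>"
    and g [measurable]: "g \<in> borel_measurable borel"
    and bounded: "AE w in \<mu>. g w \<in> {a..b}"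
    and neg: "integral\<^sup>L \<mu> g < 0"
  shows "overwhelming_probability M (\<lambda>n. {\<omega> \<in> space M. (\<Sum>k=1..n. g (X k \<omega>)) < 0})"
proof -
  define m where "m = integral\<^sup>L \<mu> g"
  \<comment> \<open>Lowering the left endpoint gives the interval positive length even if
    \<open>a = b\<close>. Hoeffding's inequality needs this, and so does the positivity of
    \<open>c\<close>, which has \<open>b - a'\<close> in its denominator.\<close>
  define a' where "a' = min a b - 1"
  define c where "c = 2 * m\<^sup>2 / (b - a')\<^sup>2"
  have a': "a' < b" "a' \<le> a" by (auto simp: a'_def)
  have m: "m < 0" using neg by (simp add: m_def)
  have X [measurable]: "k \<ge> 1 \<Longrightarrow> X k \<in> borel_measurable M" for k
    using indep by (auto simp: indep_vars_def)
  have c: "c > 0" using a' m by (simp add: c_def)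
  have gX: "distr M borel (\<lambda>\<omega>. g (X k \<omega>)) = distr \<mu> borel g" if "k \<ge> 1" for k
  proof -
    have "distr M borel (\<lambda>\<omega>. g (X k \<omega>)) = distr (distr M borel (X k)) borel g"
      using that by (subst distr_distr) (auto simp: comp_def)
    then show ?thesis using distr that by simp
  qed
  have "1 - exp (- c * real n) \<le> prob {\<omega> \<in> space M. (\<Sum>k=1..n. g (X k \<omega>)) < 0}" if "n \<ge> 1" for n
  proof -
    interpret H: Hoeffding_ineq_iid M "{1..n}" "\<lambda>k \<omega>. g (X k \<omega>)" "\<lambda>\<omega>. g (X 1 \<omega>)" a' b m
    proof unfold_locales
      have "indep_vars (\<lambda>_. borel) (\<lambda>k \<omega>. g (X k \<omega>)) {1..}"
        by (rule indep_vars_compose2[OF indep]) auto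
      then show "indep_vars (\<lambda>_. borel) (\<lambda>k \<omega>. g (X k \<omega>)) {1..n}"
        by (rule indep_vars_subset) auto
      show "distr M borel (\<lambda>\<omega>. g (X k \<omega>)) = distr M borel (\<lambda>\<omega>. g (X 1 \<omega>))" if "k \<in> {1..n}" for k
        using gX[of k] gX[of 1] that by simp
      show "AE x in M. g (X 1 x) \<in> {a'..b}"
      proof -
        have "AE x in distr M borel (X 1). g x \<in> {a'..b}"
          unfolding distr[OF order_refl] using bounded by eventually_elim (use a' in auto)
        then show ?thesis by (subst (asm) AE_distr_iff) auto
      qed
      have "m = integral\<^sup>L (distr M borel (X 1)) g" by (simp add: distr m_def)
      also have "\<dots> = expectation (\<lambda>\<omega>. g (X 1 \<omega>))" by (rule integral_distr) auto
      finally show "m \<equiv> expectation (\<lambda>\<omega>. g (X 1 \<omega>))" by simp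
    qed auto
    \<comment> \<open>The sum has mean n m < 0, so being nonnegative means exceeding the mean by at
      least -n m > 0. With this deviation the Hoeffding exponent is linear in n, with rate
      \<open>c\<close>.\<close>
    have "prob {\<omega> \<in> space M. (\<Sum>k=1..n. g (X k \<omega>)) \<ge> real n * m + (- real n * m)}
        \<le> exp (-2 * (- real n * m)\<^sup>2 / (real n * (b - a')\<^sup>2))"
      using H.Hoeffding_ineq_ge[of "- real n * m"] m a' that by (simp add: mult_nonneg_nonpos)
    also have "-2 * (- real n * m)\<^sup>2 / (real n * (b - a')\<^sup>2) = - c * real n"
      using that by (simp add: c_def power2_eq_square)
    finally have le: "prob {\<omega> \<in> space M. (\<Sum>k=1..n. g (X k \<omega>)) \<ge> 0} \<le> exp (- c * real n)" by simp
    have [measurable]: "(\<lambda>\<omega>. \<Sum>k=1..n. g (X k \<omega>)) \<in> borel_measurable M" by measurable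
    have "prob {\<omega> \<in> space M. (\<Sum>k=1..n. g (X k \<omega>)) < 0}
        = prob {\<omega> \<in> space M. \<not> (\<Sum>k=1..n. g (X k \<omega>)) \<ge> 0}" by (simp add: not_le)
    also have "\<dots> = 1 - prob {\<omega> \<in> space M. (\<Sum>k=1..n. g (X k \<omega>)) \<ge> 0}" by (rule prob_neg) measurable
    finally show ?thesis using le by simp
  qed
  then show ?thesis
    unfolding overwhelming_probability_def using c by (auto simp: eventually_sequentially)
qed

section \<open>Closure properties of overwhelming probability\<close>

lemma (in prob_space) overwhelming_probability_Int:
  assumes E: "overwhelming_probability M E" "\<And>n. E n \<in> events"
    and F: "overwhelming_probability M F" "\<And>n. F n \<in> events"
  shows "overwhelming_probability M (\<lambda>n. E n \<inter> F n)"
proof -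
  from E obtain c where c: "c > 0" "\<forall>\<^sub>F n in sequentially. prob (E n) \<ge> 1 - exp (- c * real n)"
    by (auto simp: overwhelming_probability_def)
  from F obtain d where d: "d > 0" "\<forall>\<^sub>F n in sequentially. prob (F n) \<ge> 1 - exp (- d * real n)"
    by (auto simp: overwhelming_probability_def)
  \<comment> \<open>Both failure probabilities are at most exp (-2 e n). Their sum carries a factor
    2, which is absorbed by giving up half of the rate: 2 exp (-2 e n) is at most exp (-e n) once 2
    exp (-e n) < 1.\<close>
  define e where "e = min c d / 2"
  have e: "e > 0" using c d by (simp add: e_def)
  have "((\<lambda>n. 2 * exp (- e * real n)) \<longlongrightarrow> 0) sequentially"
    using e by real_asymp
  then have "\<forall>\<^sub>F n in sequentially. 2 * exp (- e * real n) < 1"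
    by (rule order_tendstoD) simp
  with c(2) d(2) have "\<forall>\<^sub>F n in sequentially. prob (E n \<inter> F n) \<ge> 1 - exp (- e * real n)"
  proof eventually_elim
    case (elim n)
    have "prob (E n) + prob (F n) = prob (E n \<union> F n) + prob (E n \<inter> F n)"
      using E(2) F(2) by (simp add: finite_measure_Union' finite_measure_Diff' Int_commute)
    then have "prob (E n \<inter> F n) \<ge> 1 - exp (- c * real n) - exp (- d * real n)"
      using elim prob_le_1[of "E n \<union> F n"] by linarith
    moreover have "exp (- c * real n) \<le> exp (- (2 * e) * real n)" "exp (- d * real n) \<le> exp (- (2 * e) * real n)"
      by (auto simp: e_def mult_right_mono)
    moreover have "2 * exp (- (2 * e) * real n) \<le> exp (- e * real n)"
    proof -
      have "2 * exp (- (2 * e) * real n) = (2 * exp (- e * real n)) * exp (- e * real n)"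
        by (simp flip: exp_add)
      also have "\<dots> \<le> 1 * exp (- e * real n)" using elim by (intro mult_right_mono) auto
      finally show ?thesis by simp
    qed
    ultimately show ?case by linarith
  qed
  with e show ?thesis by (auto simp: overwhelming_probability_def)
qed

lemma (in prob_space) overwhelming_probability_space: "overwhelming_probability M (\<lambda>n. space M)"
  unfolding overwhelming_probability_def by (intro exI[of _ 1]) (simp add: prob_space)

lemma (in prob_space) overwhelming_probability_finite_All:
  assumes "finite I" "\<And>i. i \<in> I \<Longrightarrow> overwhelming_probability M (E i)" "\<And>i n. i \<in> I \<Longrightarrow> E i n \<in> events"
  shows "overwhelming_probability M (\<lambda>n. {\<omega> \<in> space M. \<forall>i\<in>I. \<omega> \<in> E i n})"
  using assms
proof (induction I rule: finite_induct)
  case empty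
  then show ?case by (simp add: overwhelming_probability_space)
next
  case (insert i I)
  have "{\<omega> \<in> space M. \<omega> \<in> E j n} \<in> events" if "j \<in> I" for j n
  proof -
    have "{\<omega> \<in> space M. \<omega> \<in> E j n} = E j n" using insert.prems(2)[of j n] sets.sets_into_space that by auto
    then show ?thesis using insert.prems(2) that by simp
  qed
  then have "{\<omega> \<in> space M. \<forall>j\<in>I. \<omega> \<in> E j n} \<in> events" for n
    using insert.hyps by (intro sets.sets_Collect_countable_All') (auto intro: countable_finite)
  then have "overwhelming_probability M (\<lambda>n. E i n \<inter> {\<omega> \<in> space M. \<forall>j\<in>I. \<omega> \<in> E j n})"
    using insert.IH insert.prems by (intro overwhelming_probability_Int[of "E i"]) simp_all
  moreover have "E i n \<inter> {\<omega> \<in> space M. \<forall>j\<in>I. \<omega> \<in> E j n} = {\<omega> \<in> space M. \<forall>j\<in>insert i I. \<omega> \<in> E j n}" for n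
    using insert.prems(2)[of i n] sets.sets_into_space by auto
  ultimately show ?case by simp
qed

text \<open>The implication is almost sure because the lower bound for the polynomial holds only
  when the roots lie in the support, that is, off a null set. Measurability of \<open>F n\<close>
  has to be supplied, since \<open>measure\<close> is 0 on sets that are not events.\<close>

lemma (in prob_space) overwhelming_probability_mono_AE:
  assumes E: "overwhelming_probability M E"
    and imp: "\<And>n. AE \<omega> in M. \<omega> \<in> E n \<longrightarrow> \<omega> \<in> F n"
    and F: "\<And>n. F n \<in> events"
  shows "overwhelming_probability M F"
proof -
  from E obtain c where c: "c > 0" "\<forall>\<^sub>F n in sequentially. prob (E n) \<ge> 1 - exp (- c * real n)"
    by (auto simp: overwhelming_probability_def)
  have "prob (E n) \<le> prob (F n)" for n
    using imp F by (rule finite_measure_mono_AE)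
  with c(2) have "\<forall>\<^sub>F n in sequentially. prob (F n) \<ge> 1 - exp (- c * real n)"
    by (auto elim!: eventually_mono intro: order_trans)
  with c(1) show ?thesis by (auto simp: overwhelming_probability_def)
qed

text \<open>A finite subcover reduces the claim to finitely many disks. Near each point an event
  \<open>E n\<close> that forces \<open>P\<close> on the disk stands in for the uncountable
  condition on that disk, so measurability of such a condition is asked only once, for
  \<open>K\<close> itself.\<close>

lemma (in prob_space) overwhelming_probability_compact:
  fixes K :: "'b::metric_space set"
  assumes K: "compact K"
    and local: "\<And>z. z \<in> K \<Longrightarrow> \<exists>r>0. \<exists>E. overwhelming_probability M E \<and> (\<forall>n. E n \<in> events) \<and>
      (\<forall>n. AE \<omega> in M. \<omega> \<in> E n \<longrightarrow> (\<forall>y\<in>ball z r. P n \<omega> y))"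
    and meas: "\<And>n. {\<omega> \<in> space M. \<forall>y\<in>K. P n \<omega> y} \<in> events"
  shows "overwhelming_probability M (\<lambda>n. {\<omega> \<in> space M. \<forall>y\<in>K. P n \<omega> y})"
proof -
  define Q where "Q z r E \<longleftrightarrow> r > 0 \<and> overwhelming_probability M E \<and> (\<forall>n. E n \<in> events) \<and>
      (\<forall>n. AE \<omega> in M. \<omega> \<in> E n \<longrightarrow> (\<forall>y\<in>ball z r. P n \<omega> y))" for z r E
  have "\<forall>z\<in>K. \<exists>r E. Q z r E" using local unfolding Q_def by blast
  then obtain r E where "\<forall>z\<in>K. Q z (r z) (E z)" by metis
  then have rE: "\<And>z. z \<in> K \<Longrightarrow> r z > 0"
    "\<And>z. z \<in> K \<Longrightarrow> overwhelming_probability M (E z)" "\<And>z n. z \<in> K \<Longrightarrow> E z n \<in> events"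
    "\<And>z n. z \<in> K \<Longrightarrow> AE \<omega> in M. \<omega> \<in> E z n \<longrightarrow> (\<forall>y\<in>ball z (r z). P n \<omega> y)"
    by (simp_all add: Q_def)
  have "K \<subseteq> (\<Union>z\<in>K. ball z (r z))" using rE(1) by force
  then obtain I where I: "I \<subseteq> K" "finite I" "K \<subseteq> (\<Union>z\<in>I. ball z (r z))"
    using compactE_image[OF K, of K "\<lambda>z. ball z (r z)"] open_ball by metis
  have "overwhelming_probability M (\<lambda>n. {\<omega> \<in> space M. \<forall>z\<in>I. \<omega> \<in> E z n})"
    using I rE by (intro overwhelming_probability_finite_All) auto
  then show ?thesis
  proof (rule overwhelming_probability_mono_AE[OF _ _ meas])
    fix n
    have "AE \<omega> in M. \<forall>z\<in>I. \<omega> \<in> E z n \<longrightarrow> (\<forall>y\<in>ball z (r z). P n \<omega> y)"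
      using I rE(4) by (intro AE_finite_allI) auto
    then show "AE \<omega> in M. \<omega> \<in> {\<omega> \<in> space M. \<forall>z\<in>I. \<omega> \<in> E z n} \<longrightarrow> \<omega> \<in> {\<omega> \<in> space M. \<forall>y\<in>K. P n \<omega> y}"
      by eventually_elim (use I in blast)
  qed
qed

section \<open>Support of a Borel measure\<close>

lemma closed_measure_support: "closed (measure_support \<mu>)"
proof -
  have "- measure_support \<mu> = \<Union>{U. open U \<and> emeasure \<mu> U = 0}"
    by (auto simp: measure_support_def)
  also have "open \<dots>" by auto
  finally show ?thesis by (simp add: closed_def)
qed

text \<open>The complement of the support is a union of possibly uncountably many open null sets; by
  the Lindelof property countably many of them already cover it.\<close>

lemma AE_in_measure_support:
  fixes \<mu> :: "'a::second_countable_topology measure"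
  assumes sets: "sets \<mu> = sets borel"
  shows "AE w in \<mu>. w \<in> measure_support \<mu>"
proof -
  obtain F where F: "F \<subseteq> {U. open U \<and> emeasure \<mu> U = 0}" "countable F"
      "\<Union>F = \<Union>{U. open U \<and> emeasure \<mu> U = 0}"
    using Lindelof[of "{U. open U \<and> emeasure \<mu> U = 0}"] by auto
  have "(\<Union>U\<in>F. U) \<in> null_sets \<mu>"
    using F by (intro null_sets_UN') (auto simp: null_sets_def sets)
  moreover have "- measure_support \<mu> = \<Union>F"
    unfolding F(3) by (auto simp: measure_support_def)
  ultimately show ?thesis
    by (intro AE_I'[of "\<Union>F"]) auto
qed

section \<open>Reduction to countable conditions: inequalities on sets of points and the
  inradius\<close>

lemma sets_Collect_all_less_compact:
  fixes f :: "'a \<Rightarrow> 'b::{metric_space, second_countable_topology} \<Rightarrow> real"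
  assumes K: "compact K"
    and f [measurable]: "\<And>z. (\<lambda>\<omega>. f \<omega> z) \<in> borel_measurable M"
    and cont: "\<And>\<omega>. continuous_on UNIV (f \<omega>)"
  shows "{\<omega> \<in> space M. \<forall>z\<in>K. f \<omega> z < c} \<in> sets M"
proof (cases "K = {}")
  case False
  obtain D where D: "countable D" "D \<subseteq> K" "K \<subseteq> closure D" by (rule separable)
  \<comment> \<open>A strict inequality on a dense subset does not pass to the closure. On a
    nonempty compact set the maximum is attained, so there is a uniform gap 1 / (m + 1), and the
    resulting non-strict inequality does pass by continuity.\<close>
  have "(\<forall>z\<in>K. f \<omega> z < c) \<longleftrightarrow> (\<exists>m. \<forall>z\<in>D. f \<omega> z \<le> c - 1 / real (Suc m))" for \<omega>
  proof
    assume less: "\<forall>z\<in>K. f \<omega> z < c"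
    obtain x where x: "x \<in> K" "\<And>y. y \<in> K \<Longrightarrow> f \<omega> y \<le> f \<omega> x"
      using continuous_attains_sup[OF K False continuous_on_subset[OF cont subset_UNIV]] by blast
    have "c - f \<omega> x > 0" using less x by auto
    then obtain m where "1 / real (Suc m) < c - f \<omega> x" by (rule nat_approx_posE)
    then have "\<forall>z\<in>D. f \<omega> z \<le> c - 1 / real (Suc m)" using x D(2) by fastforce
    then show "\<exists>m. \<forall>z\<in>D. f \<omega> z \<le> c - 1 / real (Suc m)" ..
  next
    assume "\<exists>m. \<forall>z\<in>D. f \<omega> z \<le> c - 1 / real (Suc m)"
    then obtain m where m: "\<forall>z\<in>D. f \<omega> z \<le> c - 1 / real (Suc m)" ..
    have "f \<omega> z \<le> c - 1 / real (Suc m)" if "z \<in> K" for z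
      using continuous_le_on_closure[OF continuous_on_subset[OF cont subset_UNIV], of z D] that D(3) m by blast
    moreover have "c - 1 / real (Suc m) < c" by simp
    ultimately show "\<forall>z\<in>K. f \<omega> z < c" by (blast intro: le_less_trans)
  qed
  then have "{\<omega> \<in> space M. \<forall>z\<in>K. f \<omega> z < c} = {\<omega> \<in> space M. \<exists>m. \<forall>z\<in>D. f \<omega> z \<le> c - 1 / real (Suc m)}"
    by simp
  also have "\<dots> \<in> sets M" 
    using D(1) by (intro sets.sets_Collect_countable_Ex sets.sets_Collect_countable_All') measurable
  finally show ?thesis .
qed simp

text \<open>Unlike a strict inequality, a non-strict one passes from a countable dense subset to all
  of \<open>L\<close> by continuity alone.\<close>

lemma sets_Collect_all_ge:
  fixes f :: "'a \<Rightarrow> 'b::{metric_space, second_countable_topology} \<Rightarrow> real"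
  assumes f [measurable]: "\<And>z. (\<lambda>\<omega>. f \<omega> z) \<in> borel_measurable M"
    and cont: "\<And>\<omega>. continuous_on UNIV (f \<omega>)"
  shows "{\<omega> \<in> space M. \<forall>z\<in>L. f \<omega> z \<ge> c} \<in> sets M"
proof -
  obtain D where D: "countable D" "D \<subseteq> L" "L \<subseteq> closure D" by (rule separable)
  have "f \<omega> z \<ge> c" if "\<forall>z\<in>D. f \<omega> z \<ge> c" "z \<in> L" for \<omega> z
    using continuous_ge_on_closure[OF continuous_on_subset[OF cont subset_UNIV], of z D] that D(3) by blast
  then have "{\<omega> \<in> space M. \<forall>z\<in>L. f \<omega> z \<ge> c} = {\<omega> \<in> space M. \<forall>z\<in>D. f \<omega> z \<ge> c}"
    using D(2) by blast
  also have "\<dots> \<in> sets M"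
    using D(1) by (intro sets.sets_Collect_countable_All') measurable
  finally show ?thesis .
qed

text \<open>This makes the inradius event measurable: with \<open>D\<close> countable, only
  countably many centers and radii occur, and the disks are closed, hence compact, so each inclusion
  in a lemniscate is an event. An open disk of radius r > b leaves room to move its center by less
  than r - b to a point of the dense set \<open>D\<close> and still contain a closed disk of radius
  b.\<close>

lemma inradius_ge_iff:
  fixes D :: "complex set"
  assumes D: "closure D = UNIV" and a: "a > 0"
  shows "inradius U \<ge> ennreal a \<longleftrightarrow> (\<forall>b\<in>\<rat>. 0 < b \<and> b < a \<longrightarrow> (\<exists>c\<in>D. cball c b \<subseteq> U))"
proof
  assume le: "inradius U \<ge> ennreal a"
  show "\<forall>b\<in>\<rat>. 0 < b \<and> b < a \<longrightarrow> (\<exists>c\<in>D. cball c b \<subseteq> U)"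
  proof (intro ballI impI)
    fix b :: real assume b: "0 < b \<and> b < a"
    then have "ennreal b < inradius U"
      using le by (intro less_le_trans[OF _ le]) (simp add: ennreal_less_iff)
    then obtain r c where r: "r > 0" "ball c r \<subseteq> U" "ennreal b < ennreal r"
      by (auto simp: inradius_def less_SUP_iff)
    then have "b < r" using b by (simp add: ennreal_less_iff)
    then obtain d where d: "d \<in> D" "dist d c < r - b"
      using closure_approachable[of c D] D by (metis UNIV_I diff_gt_0_iff_gt)
    have "cball d b \<subseteq> ball c r"
    proof
      fix y assume "y \<in> cball d b"
      then show "y \<in> ball c r" using d(2) dist_triangle[of c y d] by (simp add: dist_commute)
    qed
    then show "\<exists>c\<in>D. cball c b \<subseteq> U" using d(1) r(2) by blast
  qed
next
  assume R: "\<forall>b\<in>\<rat>. 0 < b \<and> b < a \<longrightarrow> (\<exists>c\<in>D. cball c b \<subseteq> U)"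
  show "inradius U \<ge> ennreal a"
  proof (rule ccontr)
    assume "\<not> inradius U \<ge> ennreal a"
    then have lt: "inradius U < ennreal a" by simp
    then obtain s where s: "inradius U = ennreal s" "0 \<le> s"
      by (cases "inradius U") auto
    then have "s < a" using lt by (simp add: ennreal_less_iff)
    then obtain b where b: "b \<in> \<rat>" "s < b" "b < a" using Rats_dense_in_real by blast
    then obtain c where "cball c b \<subseteq> U" using R s(2) by fastforce
    then have "ball c b \<subseteq> U" using ball_subset_cball by blast
    then have "ennreal b \<le> inradius U"
      unfolding inradius_def using b s by (intro SUP_upper) auto
    then show False using s b by (simp add: ennreal_le_iff2)
  qed
qed

lemma inradius_lower_bound: "0 < r \<Longrightarrow> ball c r \<subseteq> U \<Longrightarrow> ennreal r \<le> inradius U"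
  unfolding inradius_def by (intro SUP_upper) auto

section \<open>Logarithmic potential as a limit of integrals of shifted logarithms\<close>

context
  fixes \<mu> :: "complex measure"
  assumes prob_mu: "prob_space \<mu>"
    and sets_mu [measurable_cong]: "sets \<mu> = sets borel"
    and log_sq: "log_sq_bounded \<mu>"
begin

interpretation mu: prob_space \<mu> by (rule prob_mu)

text \<open>The uniform hypothesis is applied to the compact set {z}; restricting the integral to
  the support changes nothing because the support has full measure.\<close>

lemma nn_integral_log_dist_sq_finite: "(\<integral>\<^sup>+w. log_dist_sq z w \<partial>\<mu>) < \<infinity>"
proof -
  have "(SUP z\<in>{z}. \<integral>\<^sup>+w\<in>measure_support \<mu>. log_dist_sq z w \<partial>\<mu>) < \<infinity>"
    using log_sq compact_sing unfolding log_sq_bounded_def by blast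
  moreover have "(\<integral>\<^sup>+w\<in>measure_support \<mu>. log_dist_sq z w \<partial>\<mu>) = (\<integral>\<^sup>+w. log_dist_sq z w \<partial>\<mu>)"
    using AE_in_measure_support[OF sets_mu] by (intro nn_integral_cong_AE) auto
  ultimately show ?thesis by simp
qed

lemma borel_measurable_log_dist_sq [measurable]: "log_dist_sq z \<in> borel_measurable borel"
  unfolding log_dist_sq_def by measurable

text \<open>Since \<open>log_dist_sq\<close> is infinite at w = z, an atom at z would make its
  integral infinite. The convention \<open>ln 0 = 0\<close> is therefore harmless in the limits
  below.\<close>

lemma AE_neq: "AE w in \<mu>. w \<noteq> z"
proof -
  have "AE w in \<mu>. log_dist_sq z w \<noteq> \<infinity>"
    using nn_integral_log_dist_sq_finite[of z] by (intro nn_integral_noteq_infinite) auto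
  then show ?thesis by eventually_elim (auto simp: log_dist_sq_def)
qed

text \<open>On a probability space square integrability implies integrability, and
  \<open>log_dist_sq\<close> dominates the squared real logarithm everywhere, including w =
  z.\<close>

lemma integrable_ln_dist: "integrable \<mu> (\<lambda>w. ln (cmod (z - w)))"
proof (rule mu.square_integrable_imp_integrable)
  have "(\<integral>\<^sup>+w. ennreal ((ln (cmod (z - w)))\<^sup>2) \<partial>\<mu>) \<le> (\<integral>\<^sup>+w. log_dist_sq z w \<partial>\<mu>)"
    by (intro nn_integral_mono) (simp add: log_dist_sq_def)
  then show "integrable \<mu> (\<lambda>w. (ln (cmod (z - w)))\<^sup>2)"
    using nn_integral_log_dist_sq_finite[of z]
    by (subst integrable_iff_bounded) (auto intro: le_less_trans)
qed measurable

lemma log_potential_eq: "log_potential \<mu> z = (LINT w|\<mu>. ln (cmod (z - w)))"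
  unfolding log_potential_def set_lebesgue_integral_def
proof (intro integral_cong_AE)
  show "AE w in \<mu>. indicat_real (measure_support \<mu>) w *\<^sub>R ln (cmod (z - w)) = ln (cmod (z - w))"
    using AE_in_measure_support[OF sets_mu] by eventually_elim simp
  have [measurable]: "measure_support \<mu> \<in> sets borel"
    using closed_measure_support by (rule borel_closed)
  show "(\<lambda>w. indicat_real (measure_support \<mu>) w *\<^sub>R ln (cmod (z - w))) \<in> borel_measurable \<mu>"
    "(\<lambda>w. ln (cmod (z - w))) \<in> borel_measurable \<mu>"
    by measurable
qed

lemma ln_dist_add_tendsto_log_potential:
  "(\<lambda>m. LINT w|\<mu>. ln (cmod (z - w) + 1 / real (Suc m))) \<longlonglongrightarrow> log_potential \<mu> z"
  unfolding log_potential_eq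
proof (rule integral_dominated_convergence)
  \<comment> \<open>For x = |z - w| > 0 and a shift r in (0, 1], ln (x + r) is at least ln x, while
    x + r is at most 2 x if x >= 1 and at most 2 otherwise. This gives the dominating
    function.\<close>
  show "integrable \<mu> (\<lambda>w. \<bar>ln (cmod (z - w))\<bar> + ln 2)"
    using integrable_ln_dist by simp
  show "AE w in \<mu>. (\<lambda>m. ln (cmod (z - w) + 1 / real (Suc m))) \<longlonglongrightarrow> ln (cmod (z - w))"
    using AE_neq[of z]
  proof eventually_elim
    case (elim w)
    have "(\<lambda>m. cmod (z - w) + 1 / real (Suc m)) \<longlonglongrightarrow> cmod (z - w) + 0"
      using LIMSEQ_inverse_real_of_nat by (intro tendsto_intros) (simp add: inverse_eq_divide)
    then show ?case using elim by (intro tendsto_ln) auto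
  qed
  fix m
  show "AE w in \<mu>. norm (ln (cmod (z - w) + 1 / real (Suc m))) \<le> \<bar>ln (cmod (z - w))\<bar> + ln 2"
    using AE_neq[of z]
  proof eventually_elim
    case (elim w)
    define x where "x = cmod (z - w)"
    define r where "r = 1 / real (Suc m)"
    have x: "x > 0" and r: "0 < r" "r \<le> 1" using elim by (auto simp: x_def r_def)
    have "ln x \<le> ln (x + r)" using x r by simp
    moreover have "ln (x + r) \<le> \<bar>ln x\<bar> + ln 2"
    proof (cases "x \<ge> 1")
      case True
      then have "ln (x + r) \<le> ln (x * 2)" using r by (subst ln_le_cancel_iff) auto
      also have "\<dots> = ln x + ln 2" using x by (simp add: ln_mult)
      finally show ?thesis by linarith
    next
      case False
      then have "ln (x + r) \<le> ln 2" using x r by (subst ln_le_cancel_iff) auto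
      then show ?thesis by linarith
    qed
    moreover have "ln 2 > (0::real)" by simp
    ultimately show ?case unfolding real_norm_def x_def r_def by linarith
  qed
qed measurable

lemma ln_dist_diff_tendsto_log_potential:
  assumes d: "d > 0" "\<And>w. w \<in> measure_support \<mu> \<Longrightarrow> d \<le> cmod (z - w)"
  shows "(\<lambda>m. LINT w|\<mu>. ln (cmod (z - w) - d / real (m + 2))) \<longlonglongrightarrow> log_potential \<mu> z"
  unfolding log_potential_eq
proof (rule integral_dominated_convergence)
  \<comment> \<open>Dividing by m + 2 keeps the shift at most d / 2. On the support the argument of
    the logarithm thus lies between d / 2 and |z - w|, away from the singularity.\<close>
  show "integrable \<mu> (\<lambda>w. \<bar>ln (cmod (z - w))\<bar> + \<bar>ln (d / 2)\<bar>)"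
    using integrable_ln_dist by simp
  show "AE w in \<mu>. (\<lambda>m. ln (cmod (z - w) - d / real (m + 2))) \<longlonglongrightarrow> ln (cmod (z - w))"
    using AE_neq[of z]
  proof eventually_elim
    case (elim w)
    have "(\<lambda>m. cmod (z - w) - d / real (m + 2)) \<longlonglongrightarrow> cmod (z - w)"
      by real_asymp
    then show ?case using elim by (intro tendsto_ln) auto
  qed
  fix m
  show "AE w in \<mu>. norm (ln (cmod (z - w) - d / real (m + 2))) \<le> \<bar>ln (cmod (z - w))\<bar> + \<bar>ln (d / 2)\<bar>"
    using AE_in_measure_support[OF sets_mu]
  proof eventually_elim
    case (elim w)
    define x where "x = cmod (z - w)"
    define r where "r = d / real (m + 2)"
    have x: "d \<le> x" using d elim by (simp add: x_def)
    have r: "0 < r" "r \<le> d / 2" using d by (auto simp: r_def field_simps)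
    have "ln (x - r) \<le> ln x" "ln (d / 2) \<le> ln (x - r)"
      using x r d by auto
    then show ?case unfolding real_norm_def x_def r_def by linarith
  qed
qed measurable

end

section \<open>Random polynomials with i.i.d. roots: measurability and deterministic bounds\<close>

locale iid_roots = prob_space M for M :: "'a measure" +
  fixes \<mu> :: "complex measure" and X :: "nat \<Rightarrow> 'a \<Rightarrow> complex"
  assumes prob_mu: "prob_space \<mu>"
    and sets_mu [measurable_cong]: "sets \<mu> = sets borel"
    and compact_support: "compact (measure_support \<mu>)"
    and log_sq: "log_sq_bounded \<mu>"
    and indep: "indep_vars (\<lambda>_. borel) X {1..}"
    and distr_X: "\<And>k. k \<ge> 1 \<Longrightarrow> distr M borel (X k) = \<mu>"
begin

lemma measurable_X [measurable]: "k \<ge> 1 \<Longrightarrow> X k \<in> borel_measurable M"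
  using indep by (auto simp: indep_vars_def)

lemma AE_X_in_support: "AE \<omega> in M. \<forall>k\<in>{1..}. X k \<omega> \<in> measure_support \<mu>"
proof (rule AE_ball_countable')
  have "AE \<omega> in M. X k \<omega> \<in> measure_support \<mu>" if "k \<ge> 1" for k
  proof -
    have "AE w in distr M borel (X k). w \<in> measure_support \<mu>"
      unfolding distr_X[OF that] by (rule AE_in_measure_support[OF sets_mu])
    then show ?thesis
      using that closed_measure_support[of \<mu>] by (subst (asm) AE_distr_iff) auto
  qed
  then show "\<And>k. k \<in> {1..} \<Longrightarrow> AE \<omega> in M. X k \<omega> \<in> measure_support \<mu>" by simp
qed simp

lemma measurable_random_poly [measurable]:
  "(\<lambda>\<omega>. cmod (random_poly X n \<omega> z)) \<in> borel_measurable M"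
  unfolding random_poly_def by measurable

lemma continuous_on_cmod_random_poly: "continuous_on S (\<lambda>z. cmod (random_poly X n \<omega> z))"
  unfolding random_poly_def by (intro continuous_intros)

lemma sets_subset_lemniscate: "compact K \<Longrightarrow> {\<omega> \<in> space M. K \<subseteq> lemniscate X n \<omega>} \<in> events"
  unfolding lemniscate_def subset_iff mem_Collect_eq Ball_def[symmetric]
  by (intro sets_Collect_all_less_compact measurable_random_poly continuous_on_cmod_random_poly)

lemma sets_subset_Compl_lemniscate: "{\<omega> \<in> space M. L \<subseteq> - lemniscate X n \<omega>} \<in> events"
proof -
  have "{\<omega> \<in> space M. \<forall>z\<in>L. cmod (random_poly X n \<omega> z) \<ge> 1} \<in> events"
    by (intro sets_Collect_all_ge measurable_random_poly continuous_on_cmod_random_poly)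
  then show ?thesis by (simp add: lemniscate_def subset_iff Ball_def not_less)
qed

lemma sets_inradius_lemniscate_ge:
  assumes "a > 0"
  shows "{\<omega> \<in> space M. inradius (lemniscate X n \<omega>) \<ge> ennreal a} \<in> events"
proof -
  obtain D :: "complex set" where D: "countable D" "D \<subseteq> UNIV" "UNIV \<subseteq> closure D" by (rule separable)
  have "{\<omega> \<in> space M. \<forall>b\<in>\<rat> \<inter> {0<..<a}. \<exists>c\<in>D. cball c b \<subseteq> lemniscate X n \<omega>} \<in> events"
    by (intro sets.sets_Collect_countable_All' sets.sets_Collect_countable_Ex' D(1)
        sets_subset_lemniscate compact_cball countable_Int1 countable_rat)
  moreover have "inradius (lemniscate X n \<omega>) \<ge> ennreal a \<longleftrightarrow>
      (\<forall>b\<in>\<rat> \<inter> {0<..<a}. \<exists>c\<in>D. cball c b \<subseteq> lemniscate X n \<omega>)" for \<omega>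
    using inradius_ge_iff[of D a] D(3) assms by (auto simp: top.extremum_unique)
  ultimately show ?thesis by simp
qed

text \<open>Positive bounds on the distances to the roots become a sum of logarithms, the form that
  the i.i.d. estimate controls. Here \<open>f k\<close> will be |z - X k| + r, and in the lower
  counterpart |z - X k| - r.\<close>

lemma cmod_random_poly_le_exp:
  assumes "\<And>k. 1 \<le> k \<Longrightarrow> k \<le> n \<Longrightarrow> 0 < f k \<and> cmod (y - X k \<omega>) \<le> f k"
  shows "cmod (random_poly X n \<omega> y) \<le> exp (\<Sum>k=1..n. ln (f k))"
proof -
  have "cmod (random_poly X n \<omega> y) = (\<Prod>k=1..n. cmod (y - X k \<omega>))"
    by (simp add: random_poly_def prod_norm)
  also have "\<dots> \<le> (\<Prod>k=1..n. f k)" using assms by (intro prod_mono) auto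
  also have "\<dots> = exp (\<Sum>k=1..n. ln (f k))" using assms by (simp add: exp_sum)
  finally show ?thesis .
qed

lemma exp_le_cmod_random_poly:
  assumes "\<And>k. 1 \<le> k \<Longrightarrow> k \<le> n \<Longrightarrow> 0 < f k \<and> f k \<le> cmod (y - X k \<omega>)"
  shows "exp (\<Sum>k=1..n. ln (f k)) \<le> cmod (random_poly X n \<omega> y)"
proof -
  have "exp (\<Sum>k=1..n. ln (f k)) = (\<Prod>k=1..n. f k)" using assms by (simp add: exp_sum)
  also have "\<dots> \<le> (\<Prod>k=1..n. cmod (y - X k \<omega>))"
    using assms by (intro prod_mono) (auto simp: less_imp_le)
  also have "\<dots> = cmod (random_poly X n \<omega> y)"
    by (simp add: random_poly_def prod_norm)
  finally show ?thesis .
qed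

lemma support_cmod_bounded: obtains R where "R > 0" "\<And>w. w \<in> measure_support \<mu> \<Longrightarrow> cmod (z - w) \<le> R"
proof -
  obtain R where R: "R > 0" "measure_support \<mu> \<subseteq> ball z R"
    using bounded_subset_ballD[OF compact_imp_bounded[OF compact_support], of z] by blast
  then show ?thesis by (intro that[of R]) (auto simp: subset_eq dist_norm less_imp_le)
qed

lemma events_iid_sum_neg:
  fixes g :: "complex \<Rightarrow> real"
  assumes [measurable]: "g \<in> borel_measurable borel"
  shows "{\<omega> \<in> space M. (\<Sum>k=1..n. g (X k \<omega>)) < 0} \<in> events"
proof -
  have [measurable]: "(\<lambda>\<omega>. \<Sum>k=1..n. g (X k \<omega>)) \<in> borel_measurable M" by measurable
  show ?thesis by measurable
qed

section \<open>Inclusions and inradius with overwhelming probability\<close>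

lemma overwhelming_probability_subset_lemniscate:
  assumes K: "compact K" "K \<subseteq> Omega_minus \<mu>"
  shows "overwhelming_probability M (\<lambda>n. {\<omega> \<in> space M. K \<subseteq> lemniscate X n \<omega>})"
proof -
  have "overwhelming_probability M (\<lambda>n. {\<omega> \<in> space M. \<forall>y\<in>K. y \<in> lemniscate X n \<omega>})"
  proof (rule overwhelming_probability_compact[OF K(1)])
    fix z assume "z \<in> K"
    then have "log_potential \<mu> z < 0" using K by (auto simp: Omega_minus_def)
    then have "\<forall>\<^sub>F m in sequentially. (LINT w|\<mu>. ln (cmod (z - w) + 1 / real (Suc m))) < 0"
      by (rule order_tendstoD(2)[OF ln_dist_add_tendsto_log_potential[OF prob_mu sets_mu log_sq]])
    then obtain m where m: "(LINT w|\<mu>. ln (cmod (z - w) + 1 / real (Suc m))) < 0"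
      by (auto simp: eventually_sequentially)
    \<comment> \<open>The same number serves as shift in the logarithm and as radius of the disk:
      moving from z to a point of the disk changes the distance to any root by less than r.\<close>
    define r where "r = 1 / real (Suc m)"
    define g where "g = (\<lambda>w. ln (cmod (z - w) + r))"
    have r: "r > 0" by (simp add: r_def)
    have g [measurable]: "g \<in> borel_measurable borel" unfolding g_def by measurable
    obtain R where R: "R > 0" "\<And>w. w \<in> measure_support \<mu> \<Longrightarrow> cmod (z - w) \<le> R"
      using support_cmod_bounded[of z] by blast
    \<comment> \<open>The shift keeps \<open>g\<close> bounded below even when z itself lies in the
      support.\<close>
    have bounded: "AE w in \<mu>. g w \<in> {ln r..ln (R + r)}"
      using AE_in_measure_support[OF sets_mu]
      by eventually_elim (use r R in \<open>auto simp: g_def intro!: ln_mono add_nonneg_pos\<close>)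
    let ?E = "\<lambda>n. {\<omega> \<in> space M. (\<Sum>k=1..n. g (X k \<omega>)) < 0}"
    have "overwhelming_probability M ?E"
      using m by (intro overwhelming_probability_iid_sum_neg[OF indep distr_X g bounded]) (auto simp: g_def r_def)
    moreover have "y \<in> lemniscate X n \<omega>" if "\<omega> \<in> ?E n" "y \<in> ball z r" for n \<omega> y
    proof -
      have "cmod (random_poly X n \<omega> y) \<le> exp (\<Sum>k=1..n. g (X k \<omega>))"
        unfolding g_def
      proof (rule cmod_random_poly_le_exp)
        fix k
        have "cmod (y - X k \<omega>) \<le> cmod (y - z) + cmod (z - X k \<omega>)"
          using norm_triangle_ineq[of "y - z" "z - X k \<omega>"] by simp
        then show "0 < cmod (z - X k \<omega>) + r \<and> cmod (y - X k \<omega>) \<le> cmod (z - X k \<omega>) + r"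
          using that(2) r by (auto simp: dist_norm norm_minus_commute intro: add_nonneg_pos)
      qed
      also have "\<dots> < 1" using that(1) by simp
      finally show ?thesis by (simp add: lemniscate_def)
    qed
    ultimately show "\<exists>r>0. \<exists>E. overwhelming_probability M E \<and> (\<forall>n. E n \<in> events) \<and>
      (\<forall>n. AE \<omega> in M. \<omega> \<in> E n \<longrightarrow> (\<forall>y\<in>ball z r. y \<in> lemniscate X n \<omega>))"
      using r g events_iid_sum_neg[OF g] by (intro exI[of _ r] conjI exI[of _ ?E]) auto
  qed (use sets_subset_lemniscate[OF K(1)] in \<open>simp add: subset_eq\<close>)
  then show ?thesis by (simp add: subset_eq)
qed

lemma overwhelming_probability_subset_Compl_lemniscate:
  assumes L: "compact L" "L \<subseteq> Omega_plus \<mu> - measure_support \<mu>"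
  shows "overwhelming_probability M (\<lambda>n. {\<omega> \<in> space M. L \<subseteq> - lemniscate X n \<omega>})"
proof -
  have "overwhelming_probability M (\<lambda>n. {\<omega> \<in> space M. \<forall>y\<in>L. y \<in> - lemniscate X n \<omega>})"
  proof (rule overwhelming_probability_compact[OF L(1)])
    fix z assume z: "z \<in> L"
    then have "z \<notin> measure_support \<mu>" using L by auto
    then obtain d where d: "d > 0" "\<And>w. w \<in> measure_support \<mu> \<Longrightarrow> d \<le> cmod (z - w)"
      using separate_point_closed[OF closed_measure_support, of z \<mu>] unfolding dist_norm by blast
    have "log_potential \<mu> z > 0" using L z by (auto simp: Omega_plus_def)
    moreover have "(\<lambda>m. LINT w|\<mu>. ln (cmod (z - w) - d / real (m + 2))) \<longlonglongrightarrow> log_potential \<mu> z"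
      by (rule ln_dist_diff_tendsto_log_potential[OF prob_mu sets_mu log_sq]) (use d in auto)
    ultimately have "\<forall>\<^sub>F m in sequentially. (LINT w|\<mu>. ln (cmod (z - w) - d / real (m + 2))) > 0"
      by (intro order_tendstoD)
    then obtain m where m: "(LINT w|\<mu>. ln (cmod (z - w) - d / real (m + 2))) > 0"
      by (auto simp: eventually_sequentially)
    define r where "r = d / real (m + 2)"
    \<comment> \<open>The sign is reversed so that the estimate for negative means applies again: a
      negative sum of \<open>g\<close> says that the logarithms have a positive sum. On the support,
      \<open>g\<close> is bounded because |z - w| - r stays between d / 2 and R.\<close>
    define g where "g = (\<lambda>w. - ln (cmod (z - w) - r))"
    have r: "r > 0" "r \<le> d / 2" using d by (auto simp: r_def field_simps)
    have g [measurable]: "g \<in> borel_measurable borel" unfolding g_def by measurable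
    obtain R where R: "R > 0" "\<And>w. w \<in> measure_support \<mu> \<Longrightarrow> cmod (z - w) \<le> R"
      using support_cmod_bounded[of z] by blast
    have bounded: "AE w in \<mu>. g w \<in> {- ln R..- ln (d / 2)}"
      using AE_in_measure_support[OF sets_mu]
    proof eventually_elim
      case (elim w)
      then have "d \<le> cmod (z - w)" "cmod (z - w) \<le> R" using d R by auto
      then show ?case using r d(1) by (auto simp: g_def intro!: ln_mono)
    qed
    let ?E = "\<lambda>n. {\<omega> \<in> space M. (\<Sum>k=1..n. g (X k \<omega>)) < 0}"
    have "overwhelming_probability M ?E"
      using m by (intro overwhelming_probability_iid_sum_neg[OF indep distr_X g bounded]) (auto simp: g_def r_def)
    moreover have *: "y \<in> - lemniscate X n \<omega>"
      if "\<omega> \<in> ?E n" "y \<in> ball z r" "\<forall>k\<in>{1..}. X k \<omega> \<in> measure_support \<mu>" for n \<omega> y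
    proof -
      have "1 < exp (\<Sum>k=1..n. ln (cmod (z - X k \<omega>) - r))"
        using that(1) by (simp add: g_def sum_negf)
      also have "\<dots> \<le> cmod (random_poly X n \<omega> y)"
      proof (rule exp_le_cmod_random_poly)
        fix k :: nat assume "1 \<le> k"
        then have "d \<le> cmod (z - X k \<omega>)" using d(2) that(3) by simp
        moreover have "cmod (z - X k \<omega>) \<le> cmod (z - y) + cmod (y - X k \<omega>)"
          using norm_triangle_ineq[of "z - y" "y - X k \<omega>"] by simp
        moreover have "cmod (z - y) < r" using that(2) by (simp add: dist_norm)
        ultimately show "0 < cmod (z - X k \<omega>) - r \<and> cmod (z - X k \<omega>) - r \<le> cmod (y - X k \<omega>)"
          using r d(1) by linarith
      qed
      finally show ?thesis by (simp add: lemniscate_def)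
    qed
    \<comment> \<open>The pointwise bound needs every root at distance at least d from z, which is
      guaranteed when all roots lie in the support, hence almost surely.\<close>
    moreover have "AE \<omega> in M. \<omega> \<in> ?E n \<longrightarrow> (\<forall>y\<in>ball z r. y \<in> - lemniscate X n \<omega>)" for n
      using AE_X_in_support by (rule eventually_mono) (use * in blast)
    ultimately show "\<exists>r>0. \<exists>E. overwhelming_probability M E \<and> (\<forall>n. E n \<in> events) \<and>
      (\<forall>n. AE \<omega> in M. \<omega> \<in> E n \<longrightarrow> (\<forall>y\<in>ball z r. y \<in> - lemniscate X n \<omega>))"
      using r(1) events_iid_sum_neg[OF g] by (intro exI[of _ r] conjI exI[of _ ?E]) auto
  qed (use sets_subset_Compl_lemniscate in \<open>simp add: subset_eq\<close>)
  then show ?thesis by (simp add: subset_eq)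
qed

text \<open>Strict inequality provides an open disk in the negativity set with radius larger than a.
  The concentric closed disk of radius a is then a compact subset, and the inclusion already proved
  places it in the lemniscate.\<close>

lemma overwhelming_probability_inradius_lemniscate_ge:
  assumes a: "0 < a" "ennreal a < inradius (Omega_minus \<mu>)"
  shows "overwhelming_probability M (\<lambda>n. {\<omega> \<in> space M. inradius (lemniscate X n \<omega>) \<ge> ennreal a})"
proof -
  obtain r c where r: "r > 0" "ball c r \<subseteq> Omega_minus \<mu>" "ennreal a < ennreal r"
    using a(2) by (auto simp: inradius_def less_SUP_iff)
  then have "a < r" using a(1) by (simp add: ennreal_less_iff)
  then have "cball c a \<subseteq> Omega_minus \<mu>" using r(2) by (auto simp: subset_eq)
  then have "overwhelming_probability M (\<lambda>n. {\<omega> \<in> space M. cball c a \<subseteq> lemniscate X n \<omega>})"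
    by (intro overwhelming_probability_subset_lemniscate) auto
  then show ?thesis
  proof (rule overwhelming_probability_mono_AE[OF _ _ sets_inradius_lemniscate_ge[OF a(1)]])
    have "ennreal a \<le> inradius U" if "cball c a \<subseteq> U" for U
      using that ball_subset_cball[of c a] a(1) by (intro inradius_lower_bound[of a c]) auto
    then show "AE \<omega> in M. \<omega> \<in> {\<omega> \<in> space M. cball c a \<subseteq> lemniscate X n \<omega>} \<longrightarrow>
        \<omega> \<in> {\<omega> \<in> space M. inradius (lemniscate X n \<omega>) \<ge> ennreal a}" for n
      by auto
  qed
qed

end

theorem theorem1p1:
  fixes \<mu> :: "complex measure"
    and M :: "'a measure"
    and X :: "nat \<Rightarrow> 'a \<Rightarrow> complex"
    and K L :: "complex set"
  assumes "prob_space \<mu>"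
    and "sets \<mu> = sets borel"
    and "compact (measure_support \<mu>)"
    and "log_sq_bounded \<mu>"
    and "Omega_minus \<mu> \<noteq> {}"
    and "prob_space M"
    and "prob_space.indep_vars M (\<lambda>_. borel) X {1..}"
    and "\<And>k. k \<ge> 1 \<Longrightarrow> distr M borel (X k) = \<mu>"
    and "compact K" and "K \<subseteq> Omega_minus \<mu>"
    and "compact L" and "L \<subseteq> Omega_plus \<mu> - measure_support \<mu>"
  shows "overwhelming_probability M (\<lambda>n. {\<omega> \<in> space M. K \<subseteq> lemniscate X n \<omega>})
    \<and> overwhelming_probability M (\<lambda>n. {\<omega> \<in> space M. L \<subseteq> - lemniscate X n \<omega>})
    \<and> (\<forall>a::real. 0 < a \<and> ennreal a < inradius (Omega_minus \<mu>) \<longrightarrow>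
          overwhelming_probability M
            (\<lambda>n. {\<omega> \<in> space M. inradius (lemniscate X n \<omega>) \<ge> ennreal a}))"
proof -
  interpret prob_space M by fact
  interpret iid_roots M \<mu> X by (intro iid_roots.intro iid_roots_axioms.intro) (fact assms)+
  show ?thesis
    using overwhelming_probability_subset_lemniscate overwhelming_probability_subset_Compl_lemniscate
      overwhelming_probability_inradius_lemniscate_ge assms by blast
qed

end
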